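(* Let $d\geq 1$ and let $(e_{k,l})_{1\leq k\leq l\leq d}$ be a fixed family of elements of $C_d=\{0,1\}^d$ satisfying the binary tree assumption (H) stated in the context. Let $$X=(X_1,\ldots,X_d)=\sum_{1\leq k\leq l\leq d}X_{k,l}\,e_{k,l},\qquad Y=(Y_1,\ldots,Y_d)=\sum_{1\leq k\leq l\leq d}Y_{k,l}\,e_{k,l},$$ where $(X_{k,l})_{1\leq k\leq l\leq d}$ is a family of independent Poisson random variables with intensities $a_{k,l}\geq 0$ and $(Y_{k,l})_{1\leq k\leq l\leq d}$ is a family of independent Poisson random variables with intensities $b_{k,l}\geq 0$. Assume that $$E[X_i]\leq E[Y_i],\qquad 1\leq i\leq d,$$ and $$\mathrm{Cov}(X_i,X_j)\leq\mathrm{Cov}(Y_i,Y_j),\qquad 1\leq i<j\leq d.$$ Then $$E[\Phi(X)]\leq E[\Phi(Y)]$$ for all nondecreasing supermodular functions $\Phi:\mathbb{R}^d\to\mathbb{R}$.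
   Context: Hypercube and order: $C_d=\{0,1\}^d\subset\mathbb{R}^d$ is identified with the power set of $\{1,\ldots,d\}$ (a vector $x\in C_d$ is identified with $\{i: x_i=1\}$), ordered by inclusion. The canonical basis vector $e_k$ is identified with the singleton $\{k\}$. With this identification, $X_i=\sum_{1\leq k\leq l\leq d,\ i\in e_{k,l}}X_{k,l}$, and similarly for $Y_i$. Assumption (H): $(e_{k,l})_{1\leq k\leq l\leq d}$ is a family of $d(d+1)/2$ pairwise distinct elements of $C_d$ with $e_{k,k}=e_k$ for $k=1,\ldots,d$ (the leaves), and, for all $1\leq k<l\leq d$, one has $k,l\in e_{k,l}$ and both sets $e_{k,l}\setminus\{k\}$ and $e_{k,l}\setminus\{l\}$ (the two children of the node $e_{k,l}$) again belong to the family. A Poisson random variable with intensity $0$ is identically $0$. A function $\Phi:\mathbb{R}^d\to\mathbb{R}$ is supermodular if $\Phi(x)+\Phi(y)\leq\Phi(x\wedge y)+\Phi(x\vee y)$ for all $x,y\in\mathbb{R}^d$, where $\wedge,\vee$ are the componentwise minimum and maximum; it is nondecreasing if $\Phi(x)\leq\Phi(y)$ whenever $x_i\leq y_i$ for all $i$. For nondecreasing $\Phi$ the expectations are well defined in $(-\infty,+\infty]$, since $X$ and $Y$ have nonnegative integer components and so $\Phi(X),\Phi(Y)\geq\Phi(0)$. *)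

theory Defs
  imports "HOL-Probability.Probability"
begin

text \<open>
  A type \<open>'n\<close> of class \<open>finite\<close> and \<open>linorder\<close> plays the role of the index set \<open>{1, ..., d}\<close>
  with its usual order, so that \<open>d = CARD('n) \<ge> 1\<close>. A vertex of the hypercube \<open>{0, 1}^d\<close> is
  represented by the set of its coordinates equal to \<open>1\<close>, and \<open>cube_vec\<close> recovers the vector.
\<close>

definition cube_vec :: "'n::finite set \<Rightarrow> real ^ 'n" where
  "cube_vec A = (\<chi> i. indicator A i)"

definition tree_index :: "('n::{finite,linorder} \<times> 'n) set" where
  "tree_index = {(k, l). k \<le> l}"

text \<open>Values \<open>e k l\<close> with \<open>l < k\<close> are irrelevant, here and below.\<close>

definition binary_tree_family :: "('n::{finite,linorder} \<Rightarrow> 'n \<Rightarrow> 'n set) \<Rightarrow> bool" where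
  "binary_tree_family e \<longleftrightarrow>
     inj_on (\<lambda>(k, l). e k l) tree_index \<and>
     (\<forall>k. e k k = {k}) \<and>
     (\<forall>k l. k < l \<longrightarrow>
        k \<in> e k l \<and> l \<in> e k l \<and>
        e k l - {k} \<in> (\<lambda>(k, l). e k l) ` tree_index \<and>
        e k l - {l} \<in> (\<lambda>(k, l). e k l) ` tree_index)"

definition tree_sum ::
  "('n::{finite,linorder} \<Rightarrow> 'n \<Rightarrow> 'n set) \<Rightarrow> ('n \<Rightarrow> 'n \<Rightarrow> 'w \<Rightarrow> nat) \<Rightarrow> 'w \<Rightarrow> (real, 'n) vec" where
  "tree_sum e Z \<omega> = (\<Sum>(k, l)\<in>tree_index. real (Z k l \<omega>) *\<^sub>R cube_vec (e k l))"

text \<open>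
  The library characterises \<open>poisson_pmf a\<close> only for \<open>a > 0\<close>; a Poisson variable of
  intensity \<open>0\<close> is (almost surely) \<open>0\<close>.
\<close>

definition poisson_var :: "'w measure \<Rightarrow> real \<Rightarrow> ('w \<Rightarrow> nat) \<Rightarrow> bool" where
  "poisson_var M a Z \<longleftrightarrow>
     Z \<in> measurable M (count_space UNIV) \<and>
     distr M (count_space UNIV) Z =
       measure_pmf (if a = 0 then return_pmf 0 else poisson_pmf a)"

definition covariance :: "'w measure \<Rightarrow> ('w \<Rightarrow> real) \<Rightarrow> ('w \<Rightarrow> real) \<Rightarrow> real" where
  "covariance M U V =
     (LINT \<omega>|M. (U \<omega> - integral\<^sup>L M U) * (V \<omega> - integral\<^sup>L M V))"

text \<open>
  Expectation with values in the extended reals, as \<open>E[U\<^sup>+] - E[U\<^sup>-]\<close>; note that \<open>ennreal\<close>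
  maps negative reals to \<open>0\<close>. It is meaningful if \<open>E[U\<^sup>+]\<close> or \<open>E[U\<^sup>-]\<close> is finite, in
  particular if \<open>U\<close> is bounded below on a probability space.
\<close>

definition ext_expectation :: "'w measure \<Rightarrow> ('w \<Rightarrow> real) \<Rightarrow> ereal" where
  "ext_expectation M U =
     enn2ereal (\<integral>\<^sup>+\<omega>. ennreal (U \<omega>) \<partial>M) - enn2ereal (\<integral>\<^sup>+\<omega>. ennreal (- U \<omega>) \<partial>M)"

text \<open>On \<open>real ^ 'n\<close>, \<open>inf\<close>, \<open>sup\<close> and \<open>\<le>\<close> are componentwise.\<close>

definition supermodular :: "(real ^ 'n \<Rightarrow> real) \<Rightarrow> bool" where
  "supermodular \<Phi> \<longleftrightarrow> (\<forall>x y. \<Phi> x + \<Phi> y \<le> \<Phi> (inf x y) + \<Phi> (sup x y))"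

end

theory Submission
  imports Defs
begin

text \<open>
  The family \<open>e\<close> provides exactly one node for each pair \<open>i \<le> j\<close>, and inside a node all nodes of
  its pairs are again contained. Hence a function \<open>f\<close> on the nodes with \<open>f {} = 0\<close> is the sum, over
  the pairs \<open>i \<le> j\<close> of elements of a node, of second differences of \<open>f\<close> along the tree, and these are
  nonnegative if \<open>f\<close> is nondecreasing and supermodular. For the intensities this means: comparing
  \<open>\<Sum> a\<^bsub>k,l\<^esub> f (e\<^bsub>k,l\<^esub>)\<close> with \<open>\<Sum> b\<^bsub>k,l\<^esub> f (e\<^bsub>k,l\<^esub>)\<close> reduces to comparing the total
  intensities of the nodes containing both \<open>i\<close> and \<open>j\<close>, and these are the means (\<open>i = j\<close>) and
  covariances (\<open>i < j\<close>) of the components of \<open>X\<close> and \<open>Y\<close>.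

  With \<open>f A = g (x + 1\<^sub>A) - g x\<close> this compares the generators of the two compound Poisson
  processes. After adding multiples of the identity so that both have the same total rate \<open>C\<close>,
  the expectations are \<open>exp (- C) \<Sum> Q\<^sup>m \<Phi> / m!\<close> with positive operators \<open>Q\<close> preserving
  nondecreasing supermodular functions, so the comparison passes to all powers of \<open>Q\<close>.
\<close>

section \<open>Combinatorics of the binary tree family\<close>

lemma binary_tree_familyD:
  assumes "binary_tree_family e" and "k < l"
  shows "k \<in> e k l" "l \<in> e k l"
    and "e k l - {k} \<in> (\<lambda>(k, l). e k l) ` tree_index"
    and "e k l - {l} \<in> (\<lambda>(k, l). e k l) ` tree_index"
  using assms(1)[unfolded binary_tree_family_def, THEN conjunct2, THEN conjunct2, rule_format, OF assms(2)]
  by auto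

text \<open>Induction on the size of \<open>A = e k l\<close>. Since \<open>i \<le> j\<close> and
  \<open>k < l\<close>, a pair \<open>(i, j)\<close> other than \<open>(k, l)\<close> misses
  \<open>k\<close> or misses \<open>l\<close>, so it lies in a child of \<open>A\<close>, which is a
  smaller node.\<close>

lemma tree_node_closed:
  fixes e :: "'n::{finite,linorder} \<Rightarrow> 'n \<Rightarrow> 'n set"
  assumes e: "binary_tree_family e"
  shows "A \<in> (\<lambda>(k, l). e k l) ` tree_index \<Longrightarrow> i \<in> A \<Longrightarrow> j \<in> A \<Longrightarrow> i \<le> j \<Longrightarrow> e i j \<subseteq> A"
proof (induction "card A" arbitrary: A i j rule: less_induct)
  case less
  from less.prems(1) obtain k l where kl: "k \<le> l" "A = e k l"
    by (auto simp: tree_index_def)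
  show ?case
  proof (cases "k = l")
    case True
    with e kl have "A = {k}" by (simp add: binary_tree_family_def)
    with less.prems e show ?thesis by (simp add: binary_tree_family_def)
  next
    case False
    with kl have "k < l" by simp
    have children: "k \<in> A" "l \<in> A"
      "A - {k} \<in> (\<lambda>(k, l). e k l) ` tree_index" "A - {l} \<in> (\<lambda>(k, l). e k l) ` tree_index"
      unfolding kl(2) by (rule binary_tree_familyD[OF e \<open>k < l\<close>])+
    have smaller: "card (A - {k}) < card A" "card (A - {l}) < card A"
      using children(1,2) by (blast intro: psubset_card_mono[OF finite])+
    have "i = k \<and> j = l \<or> i \<noteq> k \<and> j \<noteq> k \<or> i \<noteq> l \<and> j \<noteq> l"
      using \<open>k < l\<close> less.prems(4) by auto
    then consider "i = k \<and> j = l" | "i \<noteq> k \<and> j \<noteq> k" | "i \<noteq> l \<and> j \<noteq> l"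
      by blast
    then show ?thesis
    proof cases
      case 1
      then show ?thesis using kl by simp
    next
      case 2
      then show ?thesis using less.hyps[OF smaller(1) children(3)] less.prems by blast
    next
      case 3
      then show ?thesis using less.hyps[OF smaller(2) children(4)] less.prems by blast
    qed
  qed
qed

text \<open>Second differences at a node also involve the set without both labels, which must again
  be a node or empty for recursion along the tree. The child \<open>e k l - {k}\<close> is some
  \<open>e i j\<close> and contains \<open>l\<close>. Were \<open>l\<close> neither \<open>i\<close>
  nor \<open>j\<close>, both would lie in the other child, and closure would put
  \<open>e i j\<close>, hence \<open>l\<close>, into \<open>e k l - {l}\<close>. So deleting
  \<open>l\<close> is one more step down the tree.\<close>

lemma tree_node_minus_both:
  fixes e :: "'n::{finite,linorder} \<Rightarrow> 'n \<Rightarrow> 'n set"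
  assumes e: "binary_tree_family e" and "k < l"
  shows "e k l - {k, l} = {} \<or> e k l - {k, l} \<in> (\<lambda>(k, l). e k l) ` tree_index"
proof -
  have kl: "k \<in> e k l" "l \<in> e k l"
    and B: "e k l - {k} \<in> (\<lambda>(k, l). e k l) ` tree_index"
    and C: "e k l - {l} \<in> (\<lambda>(k, l). e k l) ` tree_index"
    by (rule binary_tree_familyD[OF assms])+
  from B obtain i j where ij: "i \<le> j" "e k l - {k} = e i j"
    by (auto simp: tree_index_def)
  have diff: "e k l - {k, l} = e i j - {l}"
    using ij(2) by blast
  have l: "l \<in> e i j"
    unfolding ij(2)[symmetric] using kl(2) \<open>k < l\<close> by simp
  show ?thesis
  proof (cases "i = j")
    case True
    then have "e i j = {i}" using e by (simp add: binary_tree_family_def)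
    then have "e i j = {l}" using l by simp
    then show ?thesis using diff by simp
  next
    case False
    with ij have "i < j" by simp
    have nodes: "i \<in> e i j" "j \<in> e i j"
      "e i j - {i} \<in> (\<lambda>(k, l). e k l) ` tree_index" "e i j - {j} \<in> (\<lambda>(k, l). e k l) ` tree_index"
      by (rule binary_tree_familyD[OF e \<open>i < j\<close>])+
    have "l = i \<or> l = j"
    proof (rule ccontr)
      assume "\<not> (l = i \<or> l = j)"
      then have "i \<in> e k l - {l}" "j \<in> e k l - {l}"
        using nodes(1,2) unfolding ij(2)[symmetric] by auto
      then have "e i j \<subseteq> e k l - {l}"
        using tree_node_closed[OF e C _ _ ij(1)] by simp
      then show False using l by blast
    qed
    then show ?thesis using nodes(3,4) unfolding diff by (elim disjE) simp_all
  qed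
qed

text \<open>The diagonal clause agrees with the general formula when \<open>e k k = {k}\<close> and
  \<open>f {} = 0\<close>.\<close>

definition tree_difference ::
  "('n \<Rightarrow> 'n \<Rightarrow> 'n set) \<Rightarrow> ('n set \<Rightarrow> real) \<Rightarrow> 'n \<Rightarrow> 'n \<Rightarrow> real" where
  "tree_difference e f k l =
     (if k = l then f {k}
      else f (e k l) - f (e k l - {k}) - f (e k l - {l}) + f (e k l - {k, l}))"

text \<open>Both sides obey the same recursion. Pairs in \<open>A = e k l\<close> other than
  \<open>(k, l)\<close> avoid \<open>k\<close> or avoid \<open>l\<close>, so inclusion-exclusion
  expresses the sum for \<open>A\<close> through those for \<open>A - {k}\<close>,
  \<open>A - {l}\<close> and \<open>A - {k, l}\<close>; \<open>tree_difference\<close> is the term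
  that makes \<open>f\<close> satisfy this relation.\<close>

lemma tree_decomposition:
  fixes e :: "'n::{finite,linorder} \<Rightarrow> 'n \<Rightarrow> 'n set"
  assumes e: "binary_tree_family e" and f0: "f {} = 0"
  shows "A \<in> (\<lambda>(k, l). e k l) ` tree_index \<Longrightarrow>
    f A = (\<Sum>(i, j)\<in>tree_index \<inter> A \<times> A. tree_difference e f i j)"
proof (induction "card A" arbitrary: A rule: less_induct)
  case less
  let ?S = "\<lambda>A. \<Sum>(i, j)\<in>tree_index \<inter> A \<times> A. tree_difference e f i j"
  from less.prems obtain k l where kl: "k \<le> l" "A = e k l"
    by (auto simp: tree_index_def)
  show ?case
  proof (cases "k = l")
    case True
    with e kl have A: "A = {k}" by (simp add: binary_tree_family_def)
    have "tree_index \<inter> A \<times> A = {(k, k)}" unfolding A by (auto simp: tree_index_def)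
    then show ?thesis by (simp add: A tree_difference_def)
  next
    case False
    with kl have "k < l" by simp
    have children: "k \<in> A" "l \<in> A"
      "A - {k} \<in> (\<lambda>(k, l). e k l) ` tree_index" "A - {l} \<in> (\<lambda>(k, l). e k l) ` tree_index"
      unfolding kl(2) by (rule binary_tree_familyD[OF e \<open>k < l\<close>])+
    have smaller: "card (A - {k}) < card A" "card (A - {l}) < card A" "card (A - {k, l}) < card A"
      using children(1,2) by (blast intro: psubset_card_mono[OF finite])+
    have "f (A - {k}) = ?S (A - {k})" "f (A - {l}) = ?S (A - {l})"
      by (fact less.hyps[OF smaller(1) children(3)], fact less.hyps[OF smaller(2) children(4)])
    moreover have "f (A - {k, l}) = ?S (A - {k, l})"
      using tree_node_minus_both[OF e \<open>k < l\<close>, folded kl(2)]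
    proof
      \<comment> \<open>The empty set is no node, so the induction hypothesis does not cover it;
        here \<open>f {} = 0\<close> matches the empty sum.\<close>
      assume "A - {k, l} = {}"
      then show ?thesis unfolding \<open>A - {k, l} = {}\<close> using f0 by simp
    qed (fact less.hyps[OF smaller(3)])
    moreover have "?S A + ?S (A - {k, l}) = tree_difference e f k l + ?S (A - {k}) + ?S (A - {l})"
    proof -
      let ?R = "\<lambda>A. tree_index \<inter> A \<times> A"
      let ?U = "?R (A - {k}) \<union> ?R (A - {l})"
      have R: "?R A = insert (k, l) ?U"
        using children(1,2) \<open>k < l\<close> by (auto simp: tree_index_def)
      have "?S A = tree_difference e f k l + (\<Sum>(i, j)\<in>?U. tree_difference e f i j)"
        unfolding R by (subst sum.insert) auto
      moreover have "?R (A - {k}) \<inter> ?R (A - {l}) = ?R (A - {k, l})" by auto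
      ultimately show ?thesis
        using sum.union_inter[of "?R (A - {k})" "?R (A - {l})" "\<lambda>(i, j). tree_difference e f i j"]
        by simp
    qed
    moreover have "tree_difference e f k l = f A - f (A - {k}) - f (A - {l}) + f (A - {k, l})"
      using False kl(2) by (simp add: tree_difference_def)
    ultimately show ?thesis by linarith
  qed
qed

text \<open>Expanding \<open>f\<close> and exchanging the sums turns both sides into combinations of
  the same nonnegative numbers \<open>tree_difference e f i j\<close>. The coefficient is the total
  weight of the nodes containing both \<open>i\<close> and \<open>j\<close>, which \<open>le\<close>
  compares.\<close>

lemma tree_weighted_sum_le:
  fixes e :: "'n::{finite,linorder} \<Rightarrow> 'n \<Rightarrow> 'n set"
    and f :: "'n set \<Rightarrow> real" and a b :: "'n \<times> 'n \<Rightarrow> real"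
  assumes e: "binary_tree_family e" and f0: "f {} = 0"
    and pos: "\<And>i. 0 \<le> f {i}"
    and super: "\<And>A i j. i \<in> A \<Longrightarrow> j \<in> A \<Longrightarrow> i \<noteq> j \<Longrightarrow>
      f (A - {i}) + f (A - {j}) \<le> f A + f (A - {i, j})"
    and le: "\<And>i j. i \<le> j \<Longrightarrow>
      (\<Sum>(k, l)\<in>tree_index. a (k, l) * (if i \<in> e k l \<and> j \<in> e k l then 1 else 0)) \<le>
      (\<Sum>(k, l)\<in>tree_index. b (k, l) * (if i \<in> e k l \<and> j \<in> e k l then 1 else 0))"
  shows "(\<Sum>(k, l)\<in>tree_index. a (k, l) * f (e k l)) \<le> (\<Sum>(k, l)\<in>tree_index. b (k, l) * f (e k l))"
proof -
  have expand: "(\<Sum>(k, l)\<in>tree_index. c (k, l) * f (e k l)) =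
    (\<Sum>(i, j)\<in>tree_index. tree_difference e f i j *
       (\<Sum>(k, l)\<in>tree_index. c (k, l) * (if i \<in> e k l \<and> j \<in> e k l then 1 else 0)))"
    for c :: "'n \<times> 'n \<Rightarrow> real"
  proof -
    have "(\<Sum>(k, l)\<in>tree_index. c (k, l) * f (e k l)) =
      (\<Sum>(k, l)\<in>tree_index. \<Sum>(i, j)\<in>tree_index.
         c (k, l) * (if i \<in> e k l \<and> j \<in> e k l then tree_difference e f i j else 0))"
    proof (intro sum.cong refl, clarify)
      fix k l :: 'n assume "(k, l) \<in> tree_index"
      then have "f (e k l) = (\<Sum>(i, j)\<in>tree_index \<inter> e k l \<times> e k l. tree_difference e f i j)"
        by (intro tree_decomposition[where A = "e k l"] e f0) auto
      also have "\<dots> = (\<Sum>(i, j)\<in>tree_index.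
          if i \<in> e k l \<and> j \<in> e k l then tree_difference e f i j else 0)"
        by (subst sum.inter_restrict) (auto intro!: sum.cong)
      finally show "c (k, l) * f (e k l) = (\<Sum>(i, j)\<in>tree_index.
         c (k, l) * (if i \<in> e k l \<and> j \<in> e k l then tree_difference e f i j else 0))"
        by (simp add: sum_distrib_left case_prod_unfold)
    qed
    also have "\<dots> = (\<Sum>(i, j)\<in>tree_index. \<Sum>(k, l)\<in>tree_index.
         c (k, l) * (if i \<in> e k l \<and> j \<in> e k l then tree_difference e f i j else 0))"
      unfolding case_prod_unfold by (rule sum.swap)
    also have "\<dots> = (\<Sum>(i, j)\<in>tree_index. tree_difference e f i j *
       (\<Sum>(k, l)\<in>tree_index. c (k, l) * (if i \<in> e k l \<and> j \<in> e k l then 1 else 0)))"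
      by (auto intro!: sum.cong simp: sum_distrib_left)
    finally show ?thesis .
  qed
  \<comment> \<open>Here \<open>super\<close> is applied to the node \<open>e i j\<close> itself,
    which contains both of its labels.\<close>
  have "0 \<le> tree_difference e f i j" if "i \<le> j" for i j
  proof (cases "i = j")
    case True
    then show ?thesis using pos by (simp add: tree_difference_def)
  next
    case False
    with that have "i < j" by simp
    note binary_tree_familyD(1,2)[OF e this]
    with super[OF this False] False show ?thesis by (simp add: tree_difference_def)
  qed
  then show ?thesis
    unfolding expand using le
    by (intro sum_mono) (auto simp: tree_index_def intro!: mult_left_mono)
qed

section \<open>Moments and covariances of Poisson variables\<close>

text \<open>With \<open>0 ^ 0 = 1\<close> the Poisson weights also describe the point mass at 0, so
  intensity 0 needs no separate treatment afterwards.\<close>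

lemma poisson_var_distr:
  assumes "poisson_var M a Z" and "0 \<le> a"
  obtains p where "Z \<in> measurable M (count_space UNIV)" "distr M (count_space UNIV) Z = measure_pmf p"
    "\<And>n. pmf p n = a ^ n / fact n * exp (- a)"
proof (cases "a = 0")
  case True
  then show ?thesis
    using assms that[of "return_pmf 0"] by (auto simp: poisson_var_def pmf_return indicator_def)
next
  case False
  then show ?thesis
    using assms that[of "poisson_pmf a"] by (auto simp: poisson_var_def)
qed

lemma nn_integral_pmf_nat:
  fixes p :: "nat pmf"
  shows "(\<integral>\<^sup>+n. f n \<partial>measure_pmf p) = (\<Sum>n. ennreal (pmf p n) * f n)"
  by (simp add: nn_integral_measure_pmf nn_integral_count_space_nat)

text \<open>The Chen-Stein identity, by an index shift. Constant \<open>h = 1\<close> yields the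
  mean and \<open>h n = n\<close> the second moment; working in \<open>ennreal\<close> avoids
  integrability conditions.\<close>

lemma poisson_pmf_stein:
  assumes p: "\<And>n. pmf p n = a ^ n / fact n * exp (- a)" and "0 \<le> a"
  shows "(\<integral>\<^sup>+n. of_nat n * h n \<partial>measure_pmf p) = ennreal a * (\<integral>\<^sup>+n. h (Suc n) \<partial>measure_pmf p)"
proof -
  have "ennreal (pmf p (Suc n)) * of_nat (Suc n) = ennreal a * ennreal (pmf p n)" for n
  proof -
    have "pmf p (Suc n) * of_nat (Suc n) = a * pmf p n"
      unfolding p by (simp add: divide_simps)
    then show ?thesis
      by (metis ennreal_mult ennreal_of_nat_eq_real_of_nat \<open>0 \<le> a\<close> of_nat_0_le_iff pmf_nonneg)
  qed
  then have *: "ennreal (pmf p (Suc n)) * (of_nat (Suc n) * h (Suc n)) =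
      ennreal a * (ennreal (pmf p n) * h (Suc n))" for n
    by (metis mult.assoc)
  have "(\<Sum>n. ennreal (pmf p n) * (of_nat n * h n)) =
      (\<Sum>n. ennreal (pmf p (Suc n)) * (of_nat (Suc n) * h (Suc n)))"
    using suminf_offset[OF summableI, of "\<lambda>n. ennreal (pmf p n) * (of_nat n * h n)" 1] by simp
  then show ?thesis
    unfolding nn_integral_pmf_nat by (simp only: * ennreal_suminf_cmult)
qed

lemma poisson_var_moments:
  assumes M: "prob_space M" and Z: "poisson_var M a Z" and "0 \<le> a"
  shows "has_bochner_integral M (\<lambda>\<omega>. real (Z \<omega>)) a"
    and "has_bochner_integral M (\<lambda>\<omega>. real (Z \<omega>) * real (Z \<omega>)) (a * a + a)"
proof -
  interpret prob_space M by fact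
  obtain p where [measurable]: "Z \<in> measurable M (count_space UNIV)"
    and d: "distr M (count_space UNIV) Z = measure_pmf p"
    and p: "\<And>n. pmf p n = a ^ n / fact n * exp (- a)"
    using poisson_var_distr[OF Z \<open>0 \<le> a\<close>] by metis
  have E: "(\<integral>\<^sup>+\<omega>. f (Z \<omega>) \<partial>M) = (\<integral>\<^sup>+n. f n \<partial>measure_pmf p)" for f :: "nat \<Rightarrow> ennreal"
    unfolding d[symmetric] by (subst nn_integral_distr) auto
  have 1: "(\<integral>\<^sup>+n. of_nat n \<partial>measure_pmf p) = ennreal a"
    using poisson_pmf_stein[OF p \<open>0 \<le> a\<close>, of "\<lambda>_. 1"]
    by (simp add: measure_pmf.emeasure_space_1)
  have "(\<integral>\<^sup>+n. of_nat n * of_nat n \<partial>measure_pmf p) =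
      ennreal a * (\<integral>\<^sup>+n. 1 + of_nat n \<partial>measure_pmf p)"
    using poisson_pmf_stein[OF p \<open>0 \<le> a\<close>, of of_nat] by simp
  also have "\<dots> = ennreal a * (1 + ennreal a)"
    by (subst nn_integral_add) (auto simp: 1 measure_pmf.emeasure_space_1)
  also have "\<dots> = ennreal (a * a + a)"
    using \<open>0 \<le> a\<close> by (simp add: ennreal_mult ennreal_plus distrib_left add.commute)
  finally have 2: "(\<integral>\<^sup>+n. of_nat n * of_nat n \<partial>measure_pmf p) = ennreal (a * a + a)" .
  show "has_bochner_integral M (\<lambda>\<omega>. real (Z \<omega>)) a"
    using \<open>0 \<le> a\<close> 1 E[of of_nat]
    by (intro has_bochner_integral_nn_integral) (auto simp: ennreal_of_nat_eq_real_of_nat)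
  show "has_bochner_integral M (\<lambda>\<omega>. real (Z \<omega>) * real (Z \<omega>)) (a * a + a)"
    using \<open>0 \<le> a\<close> 2 E[of "\<lambda>n. of_nat n * of_nat n"]
    by (intro has_bochner_integral_nn_integral) (auto simp: ennreal_of_nat_eq_real_of_nat ennreal_mult)
qed

text \<open>Bilinear expansion: independence kills the terms with \<open>s \<noteq> t\<close>, and
  the variance \<open>a s\<close> remains on the diagonal. For indicators \<open>u\<close> and
  \<open>v\<close> of two coordinates this is the total intensity of the nodes containing
  both.\<close>

lemma covariance_poisson_sums:
  fixes a :: "'s \<Rightarrow> real" and Z :: "'s \<Rightarrow> 'w \<Rightarrow> nat" and u v :: "'s \<Rightarrow> real"
  assumes M: "prob_space M" and "finite S"
    and Z: "\<And>s. s \<in> S \<Longrightarrow> poisson_var M (a s) (Z s)" and a: "\<And>s. s \<in> S \<Longrightarrow> 0 \<le> a s"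
    and indep: "prob_space.indep_vars M (\<lambda>_. count_space UNIV) Z S"
  shows "(LINT \<omega>|M. (\<Sum>s\<in>S. real (Z s \<omega>) * u s)) = (\<Sum>s\<in>S. a s * u s)"
    and "covariance M (\<lambda>\<omega>. \<Sum>s\<in>S. real (Z s \<omega>) * u s) (\<lambda>\<omega>. \<Sum>s\<in>S. real (Z s \<omega>) * v s) =
      (\<Sum>s\<in>S. a s * (u s * v s))"
proof -
  interpret prob_space M by fact
  note mom = poisson_var_moments[OF M Z a]
  have expect: "(LINT \<omega>|M. (\<Sum>s\<in>S. real (Z s \<omega>) * u s)) = (\<Sum>s\<in>S. a s * u s)" for u
    using mom by (subst Bochner_Integration.integral_sum) (auto simp: has_bochner_integral_iff)
  show "(LINT \<omega>|M. (\<Sum>s\<in>S. real (Z s \<omega>) * u s)) = (\<Sum>s\<in>S. a s * u s)" by fact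
  let ?C = "\<lambda>s t \<omega>. (real (Z s \<omega>) - a s) * (real (Z t \<omega>) - a t)"
  have C: "has_bochner_integral M (?C s t) (if s = t then a s else 0)" if st: "s \<in> S" "t \<in> S" for s t
  proof (cases "s = t")
    case True
    have const: "has_bochner_integral M (\<lambda>\<omega>. c) c" for c :: real
      by (simp add: has_bochner_integral_iff prob_space)
    \<comment> \<open>The integrand is the expanded square of \<open>Z s - a s\<close>, and the
      value simplifies to the variance \<open>a s\<close>.\<close>
    have "has_bochner_integral M (\<lambda>\<omega>. real (Z s \<omega>) * real (Z s \<omega>) - 2 * a s * real (Z s \<omega>) + a s * a s)
      ((a s * a s + a s) - 2 * a s * a s + a s * a s)"
      by (intro const has_bochner_integral_add has_bochner_integral_diff has_bochner_integral_mult_right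
          mom(1)[OF st(1) st(1)] mom(2)[OF st(1) st(1)])
    then show ?thesis using True by (simp add: algebra_simps)
  next
    case False
    have "indep_vars (\<lambda>_. borel) (\<lambda>i \<omega>. real (Z i \<omega>) - a i) S"
      using indep_vars_compose[OF indep, of "\<lambda>i n. real n - a i" "\<lambda>_. borel"] by (simp add: comp_def)
    then have "indep_vars (\<lambda>_. borel) (\<lambda>i \<omega>. real (Z i \<omega>) - a i) {s, t}"
      by (rule indep_vars_subset) (simp add: st)
    moreover have Z: "integrable M (\<lambda>\<omega>. real (Z r \<omega>) - a r)" "(LINT \<omega>|M. real (Z r \<omega>) - a r) = 0"
      if "r \<in> {s, t}" for r
      using that mom(1)[of r] st by (auto simp: has_bochner_integral_iff prob_space)
    ultimately show ?thesis
      using False indep_vars_lebesgue_integral[of "{s, t}" "\<lambda>i \<omega>. real (Z i \<omega>) - a i"]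
        indep_vars_integrable[of "{s, t}" "\<lambda>i \<omega>. real (Z i \<omega>) - a i"] Z
      by (simp add: has_bochner_integral_iff)
  qed
  have "covariance M (\<lambda>\<omega>. \<Sum>s\<in>S. real (Z s \<omega>) * u s) (\<lambda>\<omega>. \<Sum>s\<in>S. real (Z s \<omega>) * v s) =
    (LINT \<omega>|M. (\<Sum>s\<in>S. \<Sum>t\<in>S. u s * v t * ?C s t \<omega>))"
    unfolding covariance_def expect sum_subtractf[symmetric] left_diff_distrib[symmetric]
    by (intro Bochner_Integration.integral_cong refl) (simp add: sum_product mult_ac)
  also have "\<dots> = (\<Sum>s\<in>S. \<Sum>t\<in>S. u s * v t * (if s = t then a s else 0))"
    using C by (subst Bochner_Integration.integral_sum,
      auto intro!: Bochner_Integration.integrable_sum sum.cong simp: has_bochner_integral_iff)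
  also have "\<dots> = (\<Sum>s\<in>S. a s * (u s * v s))"
    using \<open>finite S\<close> by (intro sum.cong refl) (simp add: if_distrib sum.delta cong: if_cong)
  finally show "covariance M (\<lambda>\<omega>. \<Sum>s\<in>S. real (Z s \<omega>) * u s) (\<lambda>\<omega>. \<Sum>s\<in>S. real (Z s \<omega>) * v s) =
      (\<Sum>s\<in>S. a s * (u s * v s))" .
qed

section \<open>Compound Poisson expectations as exponential series of jump operators\<close>

text \<open>Up to the scalar \<open>c + \<Sum>s\<in>S. a s\<close>, the generator of the compound Poisson process that jumps
  by \<open>v s\<close> at rate \<open>a s\<close>.\<close>

definition jump_op ::
  "real \<Rightarrow> 's set \<Rightarrow> ('s \<Rightarrow> real) \<Rightarrow> ('s \<Rightarrow> 'a::real_vector) \<Rightarrow> ('a \<Rightarrow> real) \<Rightarrow> 'a \<Rightarrow> real" where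
  "jump_op c S a v g x = c * g x + (\<Sum>s\<in>S. a s * g (x + v s))"

lemma jump_op_nonneg:
  assumes "0 \<le> c" and "\<And>s. s \<in> S \<Longrightarrow> 0 \<le> a s" and "\<And>x. 0 \<le> g x"
  shows "0 \<le> (jump_op c S a v ^^ m) g x"
  by (induction m arbitrary: x) (auto simp: jump_op_def assms intro!: add_nonneg_nonneg sum_nonneg)

text \<open>The operator is linear and commutes with translations, so it can be moved inside the
  binomial sum of the next lemma.\<close>

lemma jump_op_sum_shift:
  assumes "finite A"
  shows "jump_op c S a v (\<lambda>x. \<Sum>n\<in>A. w n * h n (x + y n)) x = (\<Sum>n\<in>A. w n * jump_op c S a v (h n) (x + y n))"
proof -
  have "(\<Sum>s\<in>S. a s * (\<Sum>n\<in>A. w n * h n (x + v s + y n))) =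
      (\<Sum>n\<in>A. \<Sum>s\<in>S. a s * (w n * h n (x + v s + y n)))"
    unfolding sum_distrib_left by (rule sum.swap)
  also have "\<dots> = (\<Sum>n\<in>A. w n * (\<Sum>s\<in>S. a s * h n (x + y n + v s)))"
    unfolding sum_distrib_left by (intro sum.cong refl) (simp add: add_ac mult_ac)
  finally show ?thesis
    by (simp add: jump_op_def distrib_left sum.distrib sum_distrib_left mult_ac)
qed

text \<open>The binomial theorem: enlarging \<open>S\<close> by \<open>t\<close> adds
  \<open>a t\<close> times the translation by \<open>v t\<close>, which commutes with
  \<open>jump_op c S a v\<close>.\<close>

lemma jump_op_insert_power:
  assumes "finite S" and "t \<notin> S"
  shows "(jump_op c (insert t S) a v ^^ k) g x =
    (\<Sum>n\<le>k. real (k choose n) * a t ^ n * (jump_op c S a v ^^ (k - n)) g (x + real n *\<^sub>R v t))"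
proof (induction k arbitrary: x)
  case 0
  then show ?case by simp
next
  case (Suc k)
  let ?Q = "jump_op c S a v" and ?Q' = "jump_op c (insert t S) a v"
  define F where "F n = a t ^ n * (?Q ^^ (Suc k - n)) g (x + real n *\<^sub>R v t)" for n
  have IH: "(?Q' ^^ k) g = (\<lambda>x. \<Sum>n\<le>k. (real (k choose n) * a t ^ n) * (?Q ^^ (k - n)) g (x + real n *\<^sub>R v t))"
    using Suc by (intro ext) simp
  have "(?Q' ^^ Suc k) g x = ?Q ((?Q' ^^ k) g) x + a t * (?Q' ^^ k) g (x + v t)"
    using assms by (simp add: jump_op_def)
  also have "?Q ((?Q' ^^ k) g) x =
      (\<Sum>n\<le>k. (real (k choose n) * a t ^ n) * ?Q ((?Q ^^ (k - n)) g) (x + real n *\<^sub>R v t))"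
    unfolding IH by (rule jump_op_sum_shift) simp
  also have "\<dots> = (\<Sum>n\<le>k. real (k choose n) * F n)"
    by (intro sum.cong refl) (simp add: F_def Suc_diff_le)
  \<comment> \<open>The new index has binomial coefficient 0. Splitting off index 0 then aligns this
    sum with the translated one for Pascal's rule.\<close>
  also have "\<dots> = (\<Sum>n\<le>Suc k. real (k choose n) * F n)"
    by simp
  also have "\<dots> = F 0 + (\<Sum>n\<le>k. real (k choose Suc n) * F (Suc n))"
    by (subst sum.atMost_Suc_shift) simp
  also have "a t * (?Q' ^^ k) g (x + v t) = (\<Sum>n\<le>k. real (k choose n) * F (Suc n))"
    unfolding IH sum_distrib_left
    by (intro sum.cong refl) (simp add: F_def algebra_simps)
  also have "F 0 + (\<Sum>n\<le>k. real (k choose Suc n) * F (Suc n)) + \<dots> =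
      F 0 + (\<Sum>n\<le>k. real (Suc k choose Suc n) * F (Suc n))"
    by (simp add: sum.distrib[symmetric] distrib_right add.commute)
  also have "\<dots> = (\<Sum>n\<le>Suc k. real (Suc k choose n) * F n)"
    by (subst sum.atMost_Suc_shift) simp
  finally show ?case by (simp only: F_def mult.assoc)
qed

lemma ennreal_suminf_diagonal:
  fixes f :: "nat \<Rightarrow> nat \<Rightarrow> ennreal"
  shows "(\<Sum>n m. f n m) = (\<Sum>k. \<Sum>n\<le>k. f n (k - n))"
proof -
  \<comment> \<open>Padding row \<open>n\<close> with zeros up to column \<open>n\<close> makes both
    indices range over all naturals, so Tonelli for counting measure exchanges the sums.\<close>
  let ?g = "\<lambda>n k. if n \<le> k then f n (k - n) else 0"
  have "(\<Sum>m. f n m) = (\<Sum>k. ?g n k)" for n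
    using suminf_offset[OF summableI, of "?g n" n] by simp
  then have "(\<Sum>n m. f n m) = (\<Sum>n k. ?g n k)" by simp
  also have "\<dots> = (\<Sum>k n. ?g n k)"
    using nn_integral_suminf[of "\<lambda>n k. ?g n k" "count_space UNIV"]
    by (simp add: nn_integral_count_space_nat)
  also have "\<dots> = (\<Sum>k. \<Sum>n\<le>k. f n (k - n))"
    by (intro suminf_cong, subst suminf_finite[of "{.._}"]) auto
  finally show ?thesis .
qed

text \<open>No regularity of \<open>h\<close> is assumed: the sum takes countably many values, and
  fixing \<open>Z t\<close> at \<open>n\<close> moves its summand into the free start point
  \<open>x\<close>.\<close>

lemma measurable_nat_combination:
  fixes v :: "'s \<Rightarrow> 'a::real_vector" and h :: "'a \<Rightarrow> 'b::topological_space"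
  assumes "finite S" and "\<And>s. s \<in> S \<Longrightarrow> Z s \<in> measurable M (count_space UNIV)"
  shows "(\<lambda>\<omega>. h (x + (\<Sum>s\<in>S. real (Z s \<omega>) *\<^sub>R v s))) \<in> borel_measurable M"
  using assms
proof (induction S arbitrary: x)
  case empty
  then show ?case by simp
next
  case (insert t S)
  have "(\<lambda>\<omega>. h ((x + real n *\<^sub>R v t) + (\<Sum>s\<in>S. real (Z s \<omega>) *\<^sub>R v s))) \<in> borel_measurable M" for n
    by (rule insert.IH) (simp add: insert.prems)
  then have "(\<lambda>\<omega>. h ((x + real (Z t \<omega>) *\<^sub>R v t) + (\<Sum>s\<in>S. real (Z s \<omega>) *\<^sub>R v s))) \<in> borel_measurable M"
    by (rule measurable_compose_countable) (simp add: insert.prems)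
  then show ?case using insert.hyps by (simp add: add.assoc)
qed

text \<open>Formally the right side is \<open>exp (- C)\<close> times \<open>exp Q\<close> applied
  to \<open>g\<close>, with \<open>Q = jump_op c S a v\<close> and \<open>C\<close> its total rate.
  Integrating out one coordinate contributes the exponential series of one translation, and the two
  series multiply because the operators commute. The scalar \<open>c\<close> cancels against its
  factor in \<open>exp (- C)\<close> and stays free for balancing rates.\<close>

lemma nn_integral_poisson_product:
  fixes v :: "'s \<Rightarrow> 'a::real_vector" and p :: "'s \<Rightarrow> nat pmf"
  assumes "finite S" and a: "\<And>s. s \<in> S \<Longrightarrow> 0 \<le> a s" and c: "0 \<le> c" and g: "\<And>x. 0 \<le> g x"
    and p: "\<And>s n. s \<in> S \<Longrightarrow> pmf (p s) n = a s ^ n / fact n * exp (- a s)"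
  shows "(\<integral>\<^sup>+f. ennreal (g (x + (\<Sum>s\<in>S. real (f s) *\<^sub>R v s))) \<partial>PiM S (\<lambda>s. measure_pmf (p s))) =
    ennreal (exp (- (c + (\<Sum>s\<in>S. a s)))) * (\<Sum>m. ennreal ((jump_op c S a v ^^ m) g x / fact m))"
  using assms(1) a p
proof (induction S arbitrary: x)
  case empty
  have "(jump_op c {} a v ^^ m) g x = c ^ m * g x" for m
    by (induction m) (auto simp: jump_op_def)
  then have "(\<Sum>m. ennreal ((jump_op c {} a v ^^ m) g x / fact m)) =
      (\<Sum>m. ennreal (c ^ m / fact m * g x))"
    by simp
  also have "\<dots> = ennreal (exp c * g x)"
  proof -
    have "(\<lambda>m. c ^ m / fact m) sums exp c"
      using exp_converges[of c] by (simp add: field_simps)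
    then have "(\<lambda>m. c ^ m / fact m * g x) sums (exp c * g x)"
      by (rule sums_mult2)
    then show ?thesis
      using c g by (intro suminf_ennreal_eq) simp_all
  qed
  finally show ?case
    using g by (simp add: ennreal_mult[symmetric] mult.assoc[symmetric] exp_minus PiM_empty)
next
  case (insert t S)
  interpret product_sigma_finite "\<lambda>s. measure_pmf (p s)"
    by unfold_locales
  let ?E = "exp (- (c + (\<Sum>s\<in>S. a s)))"
  let ?U = "\<lambda>m x. (jump_op c S a v ^^ m) g x"
  have U: "0 \<le> ?U m x" for m x
    using c g insert.prems by (intro jump_op_nonneg) auto
  have at: "0 \<le> a t" using insert.prems by simp
  have meas: "(\<lambda>f. ennreal (g (x + (\<Sum>s\<in>insert t S. real (f s) *\<^sub>R v s))))
      \<in> borel_measurable (PiM (insert t S) (\<lambda>s. measure_pmf (p s)))"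
  proof (rule measurable_nat_combination)
    fix s assume "s \<in> insert t S"
    then have "(\<lambda>f. f s) \<in> measurable (PiM (insert t S) (\<lambda>s. measure_pmf (p s))) (measure_pmf (p s))"
      by (rule measurable_component_singleton)
    then show "(\<lambda>f. f s) \<in> measurable (PiM (insert t S) (\<lambda>s. measure_pmf (p s))) (count_space UNIV)"
      by simp
  qed (simp add: insert.hyps)
  have shift: "x + (\<Sum>s\<in>insert t S. real ((f(t := n)) s) *\<^sub>R v s) =
      (x + real n *\<^sub>R v t) + (\<Sum>s\<in>S. real (f s) *\<^sub>R v s)" for f n
  proof -
    have "(\<Sum>s\<in>S. real ((f(t := n)) s) *\<^sub>R v s) = (\<Sum>s\<in>S. real (f s) *\<^sub>R v s)"
      using insert.hyps by (intro sum.cong) auto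
    then show ?thesis using insert.hyps by (simp add: add.assoc)
  qed
  have "(\<integral>\<^sup>+f. ennreal (g (x + (\<Sum>s\<in>insert t S. real (f s) *\<^sub>R v s)))
        \<partial>PiM (insert t S) (\<lambda>s. measure_pmf (p s))) =
      (\<integral>\<^sup>+n. (\<integral>\<^sup>+f. ennreal (g ((x + real n *\<^sub>R v t) + (\<Sum>s\<in>S. real (f s) *\<^sub>R v s)))
        \<partial>PiM S (\<lambda>s. measure_pmf (p s))) \<partial>measure_pmf (p t))"
    unfolding product_nn_integral_insert_rev[OF insert.hyps meas] shift ..
  also have "\<dots> = (\<integral>\<^sup>+n. ennreal ?E * (\<Sum>m. ennreal (?U m (x + real n *\<^sub>R v t) / fact m)) \<partial>measure_pmf (p t))"
    by (intro nn_integral_cong insert.IH) (simp_all add: insert.prems)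
  also have "\<dots> = (\<Sum>n. ennreal (pmf (p t) n) * (ennreal ?E * (\<Sum>m. ennreal (?U m (x + real n *\<^sub>R v t) / fact m))))"
    by (rule nn_integral_pmf_nat)
  also have "\<dots> = (\<Sum>n. ennreal (exp (- a t) * ?E) *
      (\<Sum>m. ennreal (a t ^ n / fact n * (?U m (x + real n *\<^sub>R v t) / fact m))))"
  proof (intro suminf_cong)
    fix n
    have "ennreal (pmf (p t) n) = ennreal (exp (- a t)) * ennreal (a t ^ n / fact n)"
      using at insert.prems by (simp add: ennreal_mult[symmetric] mult.commute)
    then have "ennreal (pmf (p t) n) * (ennreal ?E * (\<Sum>m. ennreal (?U m (x + real n *\<^sub>R v t) / fact m))) =
      ennreal (exp (- a t) * ?E) * (ennreal (a t ^ n / fact n) * (\<Sum>m. ennreal (?U m (x + real n *\<^sub>R v t) / fact m)))"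
      by (simp add: ennreal_mult mult_ac)
    also have "ennreal (a t ^ n / fact n) * (\<Sum>m. ennreal (?U m (x + real n *\<^sub>R v t) / fact m)) =
       (\<Sum>m. ennreal (a t ^ n / fact n * (?U m (x + real n *\<^sub>R v t) / fact m)))"
      unfolding ennreal_suminf_cmult[symmetric] using at U
      by (intro suminf_cong ennreal_mult[symmetric]) simp_all
    finally show "ennreal (pmf (p t) n) * (ennreal ?E * (\<Sum>m. ennreal (?U m (x + real n *\<^sub>R v t) / fact m))) =
      ennreal (exp (- a t) * ?E) * (\<Sum>m. ennreal (a t ^ n / fact n * (?U m (x + real n *\<^sub>R v t) / fact m)))" .
  qed
  also have "\<dots> = ennreal (exp (- a t) * ?E) *
      (\<Sum>n m. ennreal (a t ^ n / fact n * (?U m (x + real n *\<^sub>R v t) / fact m)))"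
    by (rule ennreal_suminf_cmult)
  also have "(\<Sum>n m. ennreal (a t ^ n / fact n * (?U m (x + real n *\<^sub>R v t) / fact m))) =
      (\<Sum>k. \<Sum>n\<le>k. ennreal (a t ^ n / fact n * (?U (k - n) (x + real n *\<^sub>R v t) / fact (k - n))))"
    by (rule ennreal_suminf_diagonal)
  \<comment> \<open>Multiplied by \<open>fact k\<close>, the inner sum is the binomial expansion of
    the power of the enlarged operator.\<close>
  also have "\<dots> = (\<Sum>k. ennreal ((jump_op c (insert t S) a v ^^ k) g x / fact k))"
  proof (intro suminf_cong)
    fix k
    have "(\<Sum>n\<le>k. ennreal (a t ^ n / fact n * (?U (k - n) (x + real n *\<^sub>R v t) / fact (k - n)))) =
      ennreal (\<Sum>n\<le>k. a t ^ n / fact n * (?U (k - n) (x + real n *\<^sub>R v t) / fact (k - n)))"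
      using at U by (intro sum_ennreal) (auto intro!: mult_nonneg_nonneg divide_nonneg_nonneg)
    also have "(\<Sum>n\<le>k. a t ^ n / fact n * (?U (k - n) (x + real n *\<^sub>R v t) / fact (k - n))) =
      (jump_op c (insert t S) a v ^^ k) g x / fact k"
      unfolding jump_op_insert_power[OF insert.hyps] sum_divide_distrib
      by (intro sum.cong refl) (simp add: binomial_fact)
    finally show "(\<Sum>n\<le>k. ennreal (a t ^ n / fact n * (?U (k - n) (x + real n *\<^sub>R v t) / fact (k - n)))) =
      ennreal ((jump_op c (insert t S) a v ^^ k) g x / fact k)" .
  qed
  also have "exp (- a t) * ?E = exp (- (c + (\<Sum>s\<in>insert t S. a s)))"
    using insert.hyps by (simp add: exp_add[symmetric])
  finally show ?case .
qed

lemma nn_integral_poisson_combination: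
  fixes v :: "'s \<Rightarrow> 'a::real_vector" and Z :: "'s \<Rightarrow> 'w \<Rightarrow> nat"
  assumes M: "prob_space M" and S: "finite S" "S \<noteq> {}"
    and Z: "\<And>s. s \<in> S \<Longrightarrow> poisson_var M (a s) (Z s)" and a: "\<And>s. s \<in> S \<Longrightarrow> 0 \<le> a s"
    and indep: "prob_space.indep_vars M (\<lambda>_. count_space UNIV) Z S"
    and c: "0 \<le> c" and g: "\<And>x. 0 \<le> g x"
  shows "(\<integral>\<^sup>+\<omega>. ennreal (g (x + (\<Sum>s\<in>S. real (Z s \<omega>) *\<^sub>R v s))) \<partial>M) =
    ennreal (exp (- (c + (\<Sum>s\<in>S. a s)))) * (\<Sum>m. ennreal ((jump_op c S a v ^^ m) g x / fact m))"
proof -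
  interpret prob_space M by fact
  have "\<forall>s\<in>S. \<exists>p. Z s \<in> measurable M (count_space UNIV) \<and>
      distr M (count_space UNIV) (Z s) = measure_pmf p \<and>
      (\<forall>n. pmf p n = a s ^ n / fact n * exp (- a s))"
    by (metis Z a poisson_var_distr)
  then obtain p where rv: "\<And>s. s \<in> S \<Longrightarrow> Z s \<in> measurable M (count_space UNIV)"
    and d: "\<And>s. s \<in> S \<Longrightarrow> distr M (count_space UNIV) (Z s) = measure_pmf (p s)"
    and p: "\<And>s n. s \<in> S \<Longrightarrow> pmf (p s) n = a s ^ n / fact n * exp (- a s)"
    by metis
  let ?P = "PiM S (\<lambda>_. count_space UNIV) :: ('s \<Rightarrow> nat) measure"
  \<comment> \<open>Independence means that the joint law is the product of the marginals, which
    reduces the claim to the product space.\<close>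
  have joint: "distr M ?P (\<lambda>\<omega>. \<lambda>s\<in>S. Z s \<omega>) = PiM S (\<lambda>s. measure_pmf (p s))"
    using indep_vars_iff_distr_eq_PiM'[OF S(2), where X = Z and M' = "\<lambda>_. count_space UNIV"] rv indep
      PiM_cong[OF refl d] by simp
  have "(\<integral>\<^sup>+f. ennreal (g (x + (\<Sum>s\<in>S. real (f s) *\<^sub>R v s))) \<partial>PiM S (\<lambda>s. measure_pmf (p s))) =
      (\<integral>\<^sup>+\<omega>. ennreal (g (x + (\<Sum>s\<in>S. real ((\<lambda>s\<in>S. Z s \<omega>) s) *\<^sub>R v s))) \<partial>M)"
    unfolding joint[symmetric]
  proof (rule nn_integral_distr)
    show "(\<lambda>\<omega>. \<lambda>s\<in>S. Z s \<omega>) \<in> measurable M ?P"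
      using rv by (rule measurable_restrict)
    show "(\<lambda>f. ennreal (g (x + (\<Sum>s\<in>S. real (f s) *\<^sub>R v s)))) 
        \<in> borel_measurable (distr M ?P (\<lambda>\<omega>. \<lambda>s\<in>S. Z s \<omega>))"
      unfolding measurable_distr_eq1
      by (rule measurable_nat_combination[OF S(1)]) (rule measurable_component_singleton)
  qed
  then show ?thesis
    using nn_integral_poisson_product[where S = S and a = a and c = c and g = g and p = p and x = x and v = v,
        OF S(1) a c g p] by simp
qed

section \<open>Comparison of jump operators on nondecreasing supermodular functions\<close>

lemma vec_lattice_translate:
  fixes x y z :: "real ^ 'n"
  shows "inf (x + z) (y + z) = inf x y + z" and "sup (x + z) (y + z) = sup x y + z"
  by (simp_all add: vec_eq_iff inf_vec_def sup_vec_def inf_min sup_max min_add_distrib_left max_add_distrib_left)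

lemma cube_vec_inf: "inf (cube_vec A) (cube_vec B) = cube_vec (A \<inter> B)"
  and cube_vec_sup: "sup (cube_vec A) (cube_vec B) = cube_vec (A \<union> B)"
  by (simp_all add: vec_eq_iff inf_vec_def sup_vec_def cube_vec_def inf_min sup_max indicator_def)

lemma cube_vec_nonneg: "0 \<le> cube_vec A"
  by (simp add: less_eq_vec_def cube_vec_def)

text \<open>Translations preserve the order and commute with \<open>inf\<close> and
  \<open>sup\<close>; both properties survive nonnegative combinations.\<close>

lemma jump_op_mono_supermodular:
  fixes g :: "real ^ 'n \<Rightarrow> real"
  assumes "0 \<le> c" and a: "\<And>s. s \<in> S \<Longrightarrow> 0 \<le> a s" and g: "mono g" "supermodular g"
  shows "mono (jump_op c S a v g)" and "supermodular (jump_op c S a v g)"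
proof -
  show "mono (jump_op c S a v g)"
    unfolding jump_op_def
    by (intro monoI add_mono sum_mono mult_left_mono monoD[OF g(1)] a \<open>0 \<le> c\<close> order_refl)
  show "supermodular (jump_op c S a v g)"
    unfolding supermodular_def
  proof (intro allI)
    fix x y :: "real ^ 'n"
    have sg: "g x + g y \<le> g (inf x y) + g (sup x y)" for x y
      using g(2) by (simp add: supermodular_def)
    have "(\<Sum>s\<in>S. a s * (g (x + v s) + g (y + v s))) \<le>
        (\<Sum>s\<in>S. a s * (g (inf x y + v s) + g (sup x y + v s)))"
      by (intro sum_mono mult_left_mono a) (metis sg vec_lattice_translate)
    moreover have "c * (g x + g y) \<le> c * (g (inf x y) + g (sup x y))"
      by (intro mult_left_mono sg \<open>0 \<le> c\<close>)
    ultimately show "jump_op c S a v g x + jump_op c S a v g y \<le>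
        jump_op c S a v g (inf x y) + jump_op c S a v g (sup x y)"
      by (simp add: jump_op_def distrib_left sum.distrib)
  qed
qed

text \<open>Write \<open>Q\<close> and \<open>Q'\<close> for the two operators. Positivity of
  \<open>Q\<close> lifts the induction hypothesis to
  \<open>Q (Q ^^ m) g \<le> Q (Q' ^^ m) g\<close>; then \<open>le\<close> replaces the outer
  \<open>Q\<close> by \<open>Q'\<close>, as \<open>(Q' ^^ m) g\<close> is still nondecreasing and
  supermodular.\<close>

lemma jump_op_power_le:
  fixes g :: "real ^ 'n \<Rightarrow> real"
  assumes c: "0 \<le> c" "0 \<le> c'" and a: "\<And>s. s \<in> S \<Longrightarrow> 0 \<le> a s" and b: "\<And>s. s \<in> S \<Longrightarrow> 0 \<le> b s"
    and le: "\<And>g x. mono g \<Longrightarrow> supermodular g \<Longrightarrow> jump_op c S a v g x \<le> jump_op c' S b v g x"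
    and g: "mono g" "supermodular g"
  shows "(jump_op c S a v ^^ m) g x \<le> (jump_op c' S b v ^^ m) g x"
proof (induction m arbitrary: x)
  case 0
  then show ?case by simp
next
  case (Suc m)
  let ?h = "(jump_op c' S b v ^^ m) g"
  have "mono ?h \<and> supermodular ?h"
    by (induction m) (simp_all add: g jump_op_mono_supermodular[OF c(2) b])
  moreover have "jump_op c S a v ((jump_op c S a v ^^ m) g) x \<le> jump_op c S a v ?h x"
    unfolding jump_op_def[of c] using c a
    by (intro add_mono sum_mono mult_left_mono Suc[unfolded jump_op_def[of c]]) auto
  ultimately show ?case
    using le[of ?h x] by simp
qed

text \<open>The scalars are crossed so that both operators have total rate
  \<open>sum a tree_index + sum b tree_index\<close>. The terms in \<open>g x\<close> then cancel,
  and only the weighted increments \<open>g (x + cube_vec A) - g x\<close> are compared.\<close>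

lemma tree_jump_op_le:
  fixes e :: "'n::{finite,linorder} \<Rightarrow> 'n \<Rightarrow> 'n set" and a b :: "'n \<times> 'n \<Rightarrow> real"
    and g :: "(real, 'n) vec \<Rightarrow> real"
  assumes e: "binary_tree_family e" and g: "mono g" "supermodular g"
    and le: "\<And>i j. i \<le> j \<Longrightarrow>
      (\<Sum>(k, l)\<in>tree_index. a (k, l) * (if i \<in> e k l \<and> j \<in> e k l then 1 else 0)) \<le>
      (\<Sum>(k, l)\<in>tree_index. b (k, l) * (if i \<in> e k l \<and> j \<in> e k l then 1 else 0))"
  shows "jump_op (sum b tree_index) tree_index a (\<lambda>(k, l). cube_vec (e k l)) g x \<le>
    jump_op (sum a tree_index) tree_index b (\<lambda>(k, l). cube_vec (e k l)) g x"
proof -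
  define f where "f A = g (x + cube_vec A) - g x" for A
  have cube0: "cube_vec {} = (0 :: (real, 'n) vec)"
    by (simp add: cube_vec_def vec_eq_iff)
  have "(\<Sum>(k, l)\<in>tree_index. a (k, l) * f (e k l)) \<le> (\<Sum>(k, l)\<in>tree_index. b (k, l) * f (e k l))"
  proof (rule tree_weighted_sum_le[OF e _ _ _ le])
    show "f {} = 0" by (simp add: f_def cube0)
    show "0 \<le> f {i}" for i
      using cube_vec_nonneg[of "{i}"] monoD[OF g(1), of x "x + cube_vec {i}"] by (simp add: f_def)
    show "f (A - {i}) + f (A - {j}) \<le> f A + f (A - {i, j})" if "i \<in> A" "j \<in> A" "i \<noteq> j" for A i j
    proof -
      have "(A - {i}) \<inter> (A - {j}) = A - {i, j}" "(A - {i}) \<union> (A - {j}) = A"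
        using that by auto
      then have "inf (x + cube_vec (A - {i})) (x + cube_vec (A - {j})) = x + cube_vec (A - {i, j})"
        "sup (x + cube_vec (A - {i})) (x + cube_vec (A - {j})) = x + cube_vec A"
        using vec_lattice_translate[of "cube_vec (A - {i})" x "cube_vec (A - {j})"]
        by (simp_all add: cube_vec_inf cube_vec_sup add.commute)
      then show ?thesis
        using g(2)[unfolded supermodular_def, rule_format, of "x + cube_vec (A - {i})" "x + cube_vec (A - {j})"]
        by (simp add: f_def)
    qed
  qed
  then show ?thesis
    by (simp add: jump_op_def f_def case_prod_unfold right_diff_distrib sum_subtractf sum_distrib_right)
qed

section \<open>Extended expectations and the comparison of the tree sums\<close>

lemma ext_expectation_add_const:
  fixes V :: "'w \<Rightarrow> real"
  assumes M: "prob_space M" and [measurable]: "V \<in> borel_measurable M" and V: "\<And>\<omega>. 0 \<le> V \<omega>"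
  shows "ext_expectation M (\<lambda>\<omega>. V \<omega> + c) = enn2ereal (\<integral>\<^sup>+\<omega>. ennreal (V \<omega>) \<partial>M) + ereal c"
proof -
  interpret prob_space M by fact
  let ?P = "\<integral>\<^sup>+\<omega>. ennreal (V \<omega> + c) \<partial>M" and ?N = "\<integral>\<^sup>+\<omega>. ennreal (- (V \<omega> + c)) \<partial>M"
    and ?I = "\<integral>\<^sup>+\<omega>. ennreal (V \<omega>) \<partial>M"
  \<comment> \<open>For \<open>U = V + c\<close> this is
    \<open>U\<^sup>+ + c\<^sup>- = V + (c\<^sup>+ + U\<^sup>-)\<close>, which avoids truncated
    subtraction in \<open>ennreal\<close>.\<close>
  have "ennreal (V \<omega> + c) + ennreal (max (- c) 0) =
      ennreal (V \<omega>) + (ennreal (max c 0) + ennreal (- (V \<omega> + c)))" for \<omega>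
    using V[of \<omega>]
    by (cases "0 \<le> c"; cases "0 \<le> V \<omega> + c")
      (simp_all add: ennreal_neg ennreal_plus[symmetric] del: ennreal_plus)
  then have "(\<integral>\<^sup>+\<omega>. ennreal (V \<omega> + c) + ennreal (max (- c) 0) \<partial>M) =
      (\<integral>\<^sup>+\<omega>. ennreal (V \<omega>) + (ennreal (max c 0) + ennreal (- (V \<omega> + c))) \<partial>M)"
    by simp
  then have eq: "?P + ennreal (max (- c) 0) = ?I + (ennreal (max c 0) + ?N)"
    by (simp add: nn_integral_add emeasure_space_1)
  \<comment> \<open>The negative part is bounded, hence its integral is finite and the difference in
    \<open>ext_expectation\<close> is never infinity minus infinity.\<close>
  have "?N \<le> (\<integral>\<^sup>+\<omega>. ennreal \<bar>c\<bar> \<partial>M)"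
  proof (intro nn_integral_mono ennreal_leI)
    show "- (V \<omega> + c) \<le> \<bar>c\<bar>" for \<omega> using V[of \<omega>] by linarith
  qed
  then have "?N \<le> ennreal \<bar>c\<bar>" by (simp add: emeasure_space_1)
  then obtain n where n: "0 \<le> n" "?N = ennreal n"
    by (cases ?N) (auto simp: top_unique)
  show ?thesis
  proof (cases ?I)
    case (real i)
    with eq n have "?P + ennreal (max (- c) 0) = ennreal (i + (max c 0 + n))"
      by (simp add: ennreal_plus)
    then obtain p where p: "0 \<le> p" "?P = ennreal p"
      by (cases ?P) auto
    with eq n real have "ennreal (p + max (- c) 0) = ennreal (i + (max c 0 + n))"
      by (simp add: ennreal_plus)
    then have "p + max (- c) 0 = i + (max c 0 + n)"
      using p n real by (subst (asm) ennreal_inj) auto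
    then show ?thesis
      using p n real by (simp add: ext_expectation_def)
  next
    case top
    with eq have "?P = \<top>" by (simp add: ennreal_add_eq_top)
    with top n show ?thesis by (simp add: ext_expectation_def)
  qed
qed

text \<open>Composing with \<open>x \<mapsto> sup x 0\<close> changes nothing on the nonnegative values of \<open>X\<close> and \<open>Y\<close> but
  makes the function bounded below on the whole space.\<close>

lemma positive_part_mono_supermodular:
  fixes \<Phi> :: "real ^ 'n \<Rightarrow> real"
  assumes "mono \<Phi>" and "supermodular \<Phi>"
  shows "mono (\<lambda>x. \<Phi> (sup x 0) - c)" and "supermodular (\<lambda>x. \<Phi> (sup x 0) - c)"
proof -
  show "mono (\<lambda>x. \<Phi> (sup x 0) - c)"
    by (intro monoI diff_right_mono monoD[OF assms(1)] sup_mono order_refl)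
  have "sup (inf x y) 0 = inf (sup x 0) (sup y 0)" "sup (sup x y) 0 = sup (sup x 0) (sup y 0)"
    for x y :: "real ^ 'n"
    by (auto simp: vec_eq_iff inf_vec_def sup_vec_def inf_min sup_max min_def max_def)
  then show "supermodular (\<lambda>x. \<Phi> (sup x 0) - c)"
    using assms(2) by (simp add: supermodular_def)
qed

lemma tree_sum_eq:
  "tree_sum e Z \<omega> = 0 + (\<Sum>s\<in>tree_index. real ((case s of (k, l) \<Rightarrow> Z k l) \<omega>) *\<^sub>R (case s of (k, l) \<Rightarrow> cube_vec (e k l)))"
  by (simp add: tree_sum_def case_prod_unfold)

lemma tree_sum_nonneg: "0 \<le> tree_sum e Z \<omega>"
  unfolding tree_sum_def
  by (intro sum_nonneg) (auto intro!: scaleR_nonneg_nonneg cube_vec_nonneg)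

lemma tree_sum_component:
  "tree_sum e Z \<omega> $ i =
    (\<Sum>s\<in>tree_index. real ((case s of (k, l) \<Rightarrow> Z k l) \<omega>) * (case s of (k, l) \<Rightarrow> indicator (e k l) i))"
  by (simp add: tree_sum_def case_prod_unfold cube_vec_def)

lemma tree_sum_moments:
  assumes M: "prob_space M"
    and a: "\<And>k l. k \<le> l \<Longrightarrow> 0 \<le> a k l" and Z: "\<And>k l. k \<le> l \<Longrightarrow> poisson_var M (a k l) (Z k l)"
    and indep: "prob_space.indep_vars M (\<lambda>_. count_space UNIV) (\<lambda>(k, l). Z k l) tree_index"
  shows "(LINT \<omega>|M. tree_sum e Z \<omega> $ i) = (\<Sum>(k, l)\<in>tree_index. a k l * indicator (e k l) i)"
    and "covariance M (\<lambda>\<omega>. tree_sum e Z \<omega> $ i) (\<lambda>\<omega>. tree_sum e Z \<omega> $ j) =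
      (\<Sum>(k, l)\<in>tree_index. a k l * (indicator (e k l) i * indicator (e k l) j))"
proof -
  have Z': "poisson_var M (case s of (k, l) \<Rightarrow> a k l) (case s of (k, l) \<Rightarrow> Z k l)"
    and a': "0 \<le> (case s of (k, l) \<Rightarrow> a k l)" if "s \<in> tree_index" for s
    using that a Z by (auto simp: tree_index_def)
  note moments = covariance_poisson_sums[where Z = "\<lambda>(k, l). Z k l" and a = "\<lambda>(k, l). a k l"
      and S = tree_index and M = M, OF M finite Z' a' indep]
  show "(LINT \<omega>|M. tree_sum e Z \<omega> $ i) = (\<Sum>(k, l)\<in>tree_index. a k l * indicator (e k l) i)"
    using moments(1)[where u = "\<lambda>(k, l). indicator (e k l) i"]
    by (simp add: tree_sum_component case_prod_unfold)
  show "covariance M (\<lambda>\<omega>. tree_sum e Z \<omega> $ i) (\<lambda>\<omega>. tree_sum e Z \<omega> $ j) =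
      (\<Sum>(k, l)\<in>tree_index. a k l * (indicator (e k l) i * indicator (e k l) j))"
    using moments(2)[where u = "\<lambda>(k, l). indicator (e k l) i" and v = "\<lambda>(k, l). indicator (e k l) j"]
    by (simp add: tree_sum_component case_prod_unfold)
qed

text \<open>The series formula needs a function that is nonnegative everywhere, hence the passage to
  \<open>\<Phi> (sup x 0) - \<Phi> 0\<close>; the constant is restored at the end.\<close>

lemma ext_expectation_tree_sum:
  fixes \<Phi> :: "(real, 'n::{finite,linorder}) vec \<Rightarrow> real"
  assumes M: "prob_space M"
    and a: "\<And>k l. k \<le> l \<Longrightarrow> 0 \<le> a k l" and Z: "\<And>k l. k \<le> l \<Longrightarrow> poisson_var M (a k l) (Z k l)"
    and indep: "prob_space.indep_vars M (\<lambda>_. count_space UNIV) (\<lambda>(k, l). Z k l) tree_index"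
    and "mono \<Phi>" and c: "0 \<le> c"
  shows "ext_expectation M (\<lambda>\<omega>. \<Phi> (tree_sum e Z \<omega>)) =
    enn2ereal (ennreal (exp (- (c + (\<Sum>(k, l)\<in>tree_index. a k l)))) *
      (\<Sum>m. ennreal ((jump_op c tree_index (\<lambda>(k, l). a k l) (\<lambda>(k, l). cube_vec (e k l)) ^^ m)
        (\<lambda>x. \<Phi> (sup x 0) - \<Phi> 0) 0 / fact m))) + ereal (\<Phi> 0)"
proof -
  let ?\<Psi> = "\<lambda>x. \<Phi> (sup x 0) - \<Phi> 0"
  have Z': "poisson_var M (case s of (k, l) \<Rightarrow> a k l) (case s of (k, l) \<Rightarrow> Z k l)"
    and a': "0 \<le> (case s of (k, l) \<Rightarrow> a k l)" if "s \<in> tree_index" for s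
    using that a Z by (auto simp: tree_index_def)
  have \<Psi>: "0 \<le> ?\<Psi> x" for x
    using monoD[OF \<open>mono \<Phi>\<close>, of 0 "sup x 0"] by simp
  have "sup (tree_sum e Z \<omega>) 0 = tree_sum e Z \<omega>" for \<omega>
    using tree_sum_nonneg by (rule sup_absorb1)
  then have "ext_expectation M (\<lambda>\<omega>. \<Phi> (tree_sum e Z \<omega>)) =
      ext_expectation M (\<lambda>\<omega>. ?\<Psi> (tree_sum e Z \<omega>) + \<Phi> 0)"
    by simp
  also have "\<dots> = enn2ereal (\<integral>\<^sup>+\<omega>. ennreal (?\<Psi> (tree_sum e Z \<omega>)) \<partial>M) + ereal (\<Phi> 0)"
  proof (rule ext_expectation_add_const[OF M _ \<Psi>])
    have rv: "(case s of (k, l) \<Rightarrow> Z k l) \<in> measurable M (count_space UNIV)" if "s \<in> tree_index" for s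
      using Z'[OF that] by (simp add: poisson_var_def)
    show "(\<lambda>\<omega>. ?\<Psi> (tree_sum e Z \<omega>)) \<in> borel_measurable M"
      unfolding tree_sum_eq by (rule measurable_nat_combination[OF finite rv, where h = ?\<Psi>])
  qed
  also have "(\<integral>\<^sup>+\<omega>. ennreal (?\<Psi> (tree_sum e Z \<omega>)) \<partial>M) =
      ennreal (exp (- (c + (\<Sum>s\<in>tree_index. case s of (k, l) \<Rightarrow> a k l)))) *
      (\<Sum>m. ennreal ((jump_op c tree_index (\<lambda>(k, l). a k l) (\<lambda>(k, l). cube_vec (e k l)) ^^ m) ?\<Psi> 0 / fact m))"
    unfolding tree_sum_eq
    by (rule nn_integral_poisson_combination[OF M finite _ Z' a' indep c \<Psi>]) (auto simp: tree_index_def)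
  finally show ?thesis .
qed

theorem proposition4p3:
  fixes e :: "'n::{finite,linorder} \<Rightarrow> 'n \<Rightarrow> 'n set"
    and a b :: "'n \<Rightarrow> 'n \<Rightarrow> real"
    and M :: "'v measure" and N :: "'w measure"
    and X :: "'n \<Rightarrow> 'n \<Rightarrow> 'v \<Rightarrow> nat" and Y :: "'n \<Rightarrow> 'n \<Rightarrow> 'w \<Rightarrow> nat"
    and \<Phi> :: "(real, 'n) vec \<Rightarrow> real"
  assumes "binary_tree_family e"
    and "prob_space M" and "prob_space N"
    and "\<And>k l. k \<le> l \<Longrightarrow> 0 \<le> a k l" and "\<And>k l. k \<le> l \<Longrightarrow> 0 \<le> b k l"
    and "\<And>k l. k \<le> l \<Longrightarrow> poisson_var M (a k l) (X k l)"
    and "\<And>k l. k \<le> l \<Longrightarrow> poisson_var N (b k l) (Y k l)"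
    and "prob_space.indep_vars M (\<lambda>_. count_space UNIV) (\<lambda>(k, l). X k l) tree_index"
    and "prob_space.indep_vars N (\<lambda>_. count_space UNIV) (\<lambda>(k, l). Y k l) tree_index"
    and "\<And>i. (LINT \<omega>|M. tree_sum e X \<omega> $ i) \<le> (LINT \<omega>|N. tree_sum e Y \<omega> $ i)"
    and "\<And>i j. i < j \<Longrightarrow>
           covariance M (\<lambda>\<omega>. tree_sum e X \<omega> $ i) (\<lambda>\<omega>. tree_sum e X \<omega> $ j) \<le>
           covariance N (\<lambda>\<omega>. tree_sum e Y \<omega> $ i) (\<lambda>\<omega>. tree_sum e Y \<omega> $ j)"
    and "mono \<Phi>" and "supermodular \<Phi>"
  shows "ext_expectation M (\<lambda>\<omega>. \<Phi> (tree_sum e X \<omega>)) \<le>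
         ext_expectation N (\<lambda>\<omega>. \<Phi> (tree_sum e Y \<omega>))"
proof -
  let ?a = "\<lambda>(k, l). a k l" and ?b = "\<lambda>(k, l). b k l" and ?v = "\<lambda>(k, l). cube_vec (e k l)"
  let ?\<Psi> = "\<lambda>x. \<Phi> (sup x 0) - \<Phi> 0"
  let ?A = "sum ?a tree_index" and ?B = "sum ?b tree_index"
  have a: "0 \<le> ?a s" and b: "0 \<le> ?b s" if "s \<in> tree_index" for s
    using that assms(4,5) by (auto simp: tree_index_def)
  have A: "0 \<le> ?A" and B: "0 \<le> ?B"
    using a b by (auto intro!: sum_nonneg)
  \<comment> \<open>The means settle the diagonal pairs, the covariances the others.\<close>
  have le: "(\<Sum>(k, l)\<in>tree_index. ?a (k, l) * (if i \<in> e k l \<and> j \<in> e k l then 1 else 0)) \<le>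
      (\<Sum>(k, l)\<in>tree_index. ?b (k, l) * (if i \<in> e k l \<and> j \<in> e k l then 1 else 0))" if "i \<le> j" for i j
  proof (cases "i = j")
    case True
    then show ?thesis
      using assms(10)[of i] tree_sum_moments(1)[OF assms(2,4,6,8), of e i]
        tree_sum_moments(1)[OF assms(3,5,7,9), of e i]
      by (simp add: indicator_def of_bool_def)
  next
    case False
    with that have "i < j" by simp
    have ind: "indicator (e k l) i * indicator (e k l) j =
        (if i \<in> e k l \<and> j \<in> e k l then 1 else 0 :: real)" for k l
      by (simp add: indicator_def)
    show ?thesis
      using assms(11)[OF \<open>i < j\<close>] tree_sum_moments(2)[OF assms(2,4,6,8), of e i j]
        tree_sum_moments(2)[OF assms(3,5,7,9), of e i j]
      unfolding ind by simp
  qed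
  \<comment> \<open>Each operator carries the total intensity of the other family as its scalar, so
    the two series have the same prefactor \<open>exp (- (?A + ?B))\<close> and can be compared term
    by term.\<close>
  have "(jump_op ?B tree_index ?a ?v ^^ m) ?\<Psi> 0 \<le> (jump_op ?A tree_index ?b ?v ^^ m) ?\<Psi> 0" for m
    by (intro jump_op_power_le[OF B A] a b positive_part_mono_supermodular[OF assms(12,13)]
        tree_jump_op_le[OF assms(1)] le)
  then have "(\<Sum>m. ennreal ((jump_op ?B tree_index ?a ?v ^^ m) ?\<Psi> 0 / fact m)) \<le>
      (\<Sum>m. ennreal ((jump_op ?A tree_index ?b ?v ^^ m) ?\<Psi> 0 / fact m))"
    by (intro suminf_le summableI ennreal_leI divide_right_mono) auto
  then show ?thesis
    by (simp only: ext_expectation_tree_sum[OF assms(2,4,6,8,12) B]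
        ext_expectation_tree_sum[OF assms(3,5,7,9,12) A] add.commute[of ?B ?A])
      (intro add_right_mono less_eq_ennreal.rep_eq[THEN iffD1] mult_left_mono, simp_all)
qed

end
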